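(* Let $1\le p<n$ be integers. The map $\varphi_{\mathrm{pbw}}$ is an isomorphism between the posets $(\tilde{\mathcal I}_{\mathrm{pbw}},\prec_{\mathrm{pbw}})$ and $(\mathcal J(\tilde Q),\subset)$.
   Context: Notation: $\mathbb N_0=\{0,1,2,\dots\}$, and $[a,b]$ denotes the set of integers $x$ with $a\le x\le b$ (empty if $a>b$). Fix integers $1\le p<n$. For an integer $a$, "$a \bmod n$" denotes the representative of $a$ modulo $n$ lying in $[1,n]$; $\bmod$ is performed after addition and subtraction. A tuple $(\alpha_1,\dots,\alpha_p)$ of integers in $[1,n]$ is a PBW tuple if the $\alpha_j$ are pairwise distinct, $\alpha_j\le p$ implies $\alpha_j=j$, and $\alpha_j>\alpha_k>p$ implies $j<k$. $\tilde{\mathcal I}_{\mathrm{pbw}}$ is the set of symbols $I^{(k)}$ with $I=(\alpha_1,\dots,\alpha_p)$ a $p$-tuple in $[1,n]$ and $k\in\mathbb N_0$ such that $(\alpha_1-k\bmod n,\dots,\alpha_p-k\bmod n)$ is a PBW tuple. For $I^{(k)},I'^{(k')}\in\tilde{\mathcal I}_{\mathrm{pbw}}$ with $I=(\alpha_1,\dots,\alpha_p)$ and $I'=(\alpha'_1,\dots,\alpha'_p)$ set $I^{(k)}\preceq_{\mathrm{pbw}}I'^{(k')}$ iff $k\le k'$ and for every $i\in[k'-k+1,p]$ there exists $i'\in[i-(k'-k),p]$ such that $k+(\alpha_i-k\bmod n)\le k'+(\alpha'_{i'}-k'\bmod n)$; $\prec_{\mathrm{pbw}}$ is the corresponding strict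 relation. The poset $(\tilde Q,\prec)$ consists of elements $q_{i,j}$ with integers $i\ge1$, $j\ge p+1$, $j-i\in[0,n-1]$, where $q_{i_1,j_1}\preceq q_{i_2,j_2}$ iff at least one of: (i) $i_1\le i_2$ and $j_1\le j_2$; (ii) $i_1+p\le i_2$; (iii) $j_1+n-p\le j_2$. $\mathcal J(\tilde Q)$ is the set of finite order ideals (finite down-closed subsets), ordered by inclusion. For $I^{(k)}\in\tilde{\mathcal I}_{\mathrm{pbw}}$ with $I=(\alpha_1,\dots,\alpha_p)$, $\varphi_{\mathrm{pbw}}(I^{(k)})\in\mathcal J(\tilde Q)$ is the minimal order ideal of $(\tilde Q,\prec)$ containing all elements $q_{k+i,\,k+(\alpha_i-k\bmod n)}$ with $i\in[1,p]$ and $k+(\alpha_i-k\bmod n)>p$. *)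

theory Defs
  imports Main "HOL-Library.FuncSet"
begin

text \<open>The representative of a modulo n in [1,n], as opposed to [0,n-1] for mod.\<close>

definition rmod :: "int \<Rightarrow> int \<Rightarrow> int" (infixl "rmod" 70) where
  "a rmod n = (a - 1) mod n + 1"

lemma rmod_range: "0 < n \<Longrightarrow> a rmod n \<in> {1..n}"
  unfolding rmod_def atLeastAtMost_iff
  using pos_mod_sign[of n "a - 1"] pos_mod_bound[of n "a - 1"] by linarith

lemma rmod_cong: "(a rmod n) mod n = a mod n"
  by (simp add: rmod_def mod_simps)

text \<open>A p-tuple in [1,n] is an extensional function on the index set {1..p}, so that equality
  of tuples is equality of functions.\<close>

definition tuples :: "int \<Rightarrow> int \<Rightarrow> (int \<Rightarrow> int) set" where
  "tuples p n = {1..p} \<rightarrow>\<^sub>E {1..n}"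

definition pbw_tuple :: "int \<Rightarrow> int \<Rightarrow> (int \<Rightarrow> int) \<Rightarrow> bool" where
  "pbw_tuple p n \<alpha> \<longleftrightarrow>
     \<alpha> \<in> tuples p n \<and>
     inj_on \<alpha> {1..p} \<and>
     (\<forall>j\<in>{1..p}. \<alpha> j \<le> p \<longrightarrow> \<alpha> j = j) \<and>
     (\<forall>j\<in>{1..p}. \<forall>k\<in>{1..p}. \<alpha> j > \<alpha> k \<and> \<alpha> k > p \<longrightarrow> j < k)"

definition I_pbw :: "int \<Rightarrow> int \<Rightarrow> ((int \<Rightarrow> int) \<times> nat) set" where
  "I_pbw p n = {(\<alpha>, k). \<alpha> \<in> tuples p n \<and>
     pbw_tuple p n (\<lambda>j\<in>{1..p}. (\<alpha> j - int k) rmod n)}"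

definition pbw_le :: "int \<Rightarrow> int \<Rightarrow> ((int \<Rightarrow> int) \<times> nat) rel" where
  "pbw_le p n = {((\<alpha>, k), (\<alpha>', k')).
     (\<alpha>, k) \<in> I_pbw p n \<and> (\<alpha>', k') \<in> I_pbw p n \<and>
     k \<le> k' \<and>
     (\<forall>i\<in>{int k' - int k + 1..p}. \<exists>i'\<in>{i - (int k' - int k)..p}.
        int k + (\<alpha> i - int k) rmod n \<le> int k' + (\<alpha>' i' - int k') rmod n)}"

text \<open>The element \<open>q\<^sub>i\<^sub>,\<^sub>j\<close> is encoded as the pair of its indices.\<close>

definition Q_elems :: "int \<Rightarrow> int \<Rightarrow> (int \<times> int) set" where
  "Q_elems p n = {(i, j). i \<ge> 1 \<and> j \<ge> p + 1 \<and> j - i \<in> {0..n - 1}}"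

definition Q_le :: "int \<Rightarrow> int \<Rightarrow> (int \<times> int) rel" where
  "Q_le p n = {((i1, j1), (i2, j2)).
     (i1, j1) \<in> Q_elems p n \<and> (i2, j2) \<in> Q_elems p n \<and>
     (i1 \<le> i2 \<and> j1 \<le> j2 \<or> i1 + p \<le> i2 \<or> j1 + n - p \<le> j2)}"

lemma partial_order_on_Q:
  assumes "1 \<le> p" "p < n"
  shows "partial_order_on (Q_elems p n) (Q_le p n)"
  unfolding partial_order_on_def preorder_on_def
proof (intro conjI)
  show "Q_le p n \<subseteq> Q_elems p n \<times> Q_elems p n"
    by (auto simp: Q_le_def)
  show "refl_on (Q_elems p n) (Q_le p n)"
    by (auto simp: refl_on_def Q_le_def)
  show "trans (Q_le p n)"
  proof (rule transI, clarify)
    fix a b c d e f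
    assume "((a, b), (c, d)) \<in> Q_le p n" "((c, d), (e, f)) \<in> Q_le p n"
    then have "(a, b) \<in> Q_elems p n" "(e, f) \<in> Q_elems p n"
      "0 \<le> b - a" "b - a < n" "0 \<le> d - c" "d - c < n" "0 \<le> f - e" "f - e < n"
      "a \<le> c \<and> b \<le> d \<or> a + p \<le> c \<or> b + n - p \<le> d"
      "c \<le> e \<and> d \<le> f \<or> c + p \<le> e \<or> d + n - p \<le> f"
      by (simp_all add: Q_le_def Q_elems_def)
    moreover from this(3-) assms
    have "a \<le> e \<and> b \<le> f \<or> a + p \<le> e \<or> b + n - p \<le> f"
      by linarith
    ultimately show "((a, b), (e, f)) \<in> Q_le p n"
      by (simp add: Q_le_def)
  qed
  show "antisym (Q_le p n)"
  proof (rule antisymI, clarify)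
    fix a b c d
    assume "((a, b), (c, d)) \<in> Q_le p n" "((c, d), (a, b)) \<in> Q_le p n"
    then have "0 \<le> b - a" "b - a < n" "0 \<le> d - c" "d - c < n"
      "a \<le> c \<and> b \<le> d \<or> a + p \<le> c \<or> b + n - p \<le> d"
      "c \<le> a \<and> d \<le> b \<or> c + p \<le> a \<or> d + n - p \<le> b"
      by (simp_all add: Q_le_def Q_elems_def)
    with assms show "a = c \<and> b = d"
      by linarith
  qed
qed

definition order_ideal :: "'a set \<Rightarrow> 'a rel \<Rightarrow> 'a set \<Rightarrow> bool" where
  "order_ideal A r J \<longleftrightarrow> J \<subseteq> A \<and> (\<forall>y\<in>J. \<forall>x\<in>A. (x, y) \<in> r \<longrightarrow> x \<in> J)"

definition ideal_generated :: "'a set \<Rightarrow> 'a rel \<Rightarrow> 'a set \<Rightarrow> 'a set" where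
  "ideal_generated A r S = \<Inter> {J. order_ideal A r J \<and> S \<subseteq> J}"

text \<open>For S a subset of A the intersection above is the minimal order ideal containing S.\<close>

lemma ideal_generated_least:
  assumes "S \<subseteq> A"
  shows "order_ideal A r (ideal_generated A r S)" "S \<subseteq> ideal_generated A r S"
    "order_ideal A r J \<Longrightarrow> S \<subseteq> J \<Longrightarrow> ideal_generated A r S \<subseteq> J"
proof -
  have "order_ideal A r A" by (simp add: order_ideal_def)
  with assms show "order_ideal A r (ideal_generated A r S)"
    unfolding ideal_generated_def order_ideal_def by blast
qed (auto simp: ideal_generated_def)

definition finite_ideals :: "'a set \<Rightarrow> 'a rel \<Rightarrow> 'a set set" where
  "finite_ideals A r = {J. order_ideal A r J \<and> finite J}"

definition phi_gens :: "int \<Rightarrow> int \<Rightarrow> (int \<Rightarrow> int) \<times> nat \<Rightarrow> (int \<times> int) set" where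
  "phi_gens p n = (\<lambda>(\<alpha>, k).
     {(int k + i, int k + (\<alpha> i - int k) rmod n) | i.
        i \<in> {1..p} \<and> int k + (\<alpha> i - int k) rmod n > p})"

lemma phi_gens_subset:
  assumes "1 \<le> p" "p < n" "x \<in> I_pbw p n"
  shows "phi_gens p n x \<subseteq> Q_elems p n"
proof
  fix q assume q: "q \<in> phi_gens p n x"
  obtain \<alpha> k where x: "x = (\<alpha>, k)" by force
  obtain i where i: "i \<in> {1..p}" "int k + (\<alpha> i - int k) rmod n > p"
    and q_eq: "q = (int k + i, int k + (\<alpha> i - int k) rmod n)"
    using q by (auto simp: phi_gens_def x)
  have "\<forall>j\<in>{1..p}. (\<lambda>j\<in>{1..p}. (\<alpha> j - int k) rmod n) j \<le> p \<longrightarrow>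
      (\<lambda>j\<in>{1..p}. (\<alpha> j - int k) rmod n) j = j"
    using assms(3) unfolding x I_pbw_def pbw_tuple_def by blast
  from bspec[OF this i(1)] have "(\<alpha> i - int k) rmod n \<le> p \<longrightarrow> (\<alpha> i - int k) rmod n = i"
    using i(1) by (simp only: restrict_apply if_True)
  moreover have "(\<alpha> i - int k) rmod n \<in> {1..n}"
    by (rule rmod_range) (use assms in linarith)
  ultimately have "1 \<le> int k + i" "0 \<le> (\<alpha> i - int k) rmod n - i"
      "(\<alpha> i - int k) rmod n - i \<le> n - 1"
    using i(1) unfolding atLeastAtMost_iff by linarith+
  then show "q \<in> Q_elems p n"
    using i(2) by (simp add: q_eq Q_elems_def)
qed

definition phi_pbw :: "int \<Rightarrow> int \<Rightarrow> (int \<Rightarrow> int) \<times> nat \<Rightarrow> (int \<times> int) set" where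
  "phi_pbw p n x = ideal_generated (Q_elems p n) (Q_le p n) (phi_gens p n x)"

definition inclusion_on :: "'a set set \<Rightarrow> 'a set rel" where
  "inclusion_on B = {(X, Y). X \<in> B \<and> Y \<in> B \<and> X \<subseteq> Y}"

definition poset_iso :: "'a set \<Rightarrow> 'a rel \<Rightarrow> 'b set \<Rightarrow> 'b rel \<Rightarrow> ('a \<Rightarrow> 'b) \<Rightarrow> bool" where
  "poset_iso A r B s f \<longleftrightarrow>
     partial_order_on A r \<and> partial_order_on B s \<and>
     bij_betw f A B \<and>
     (\<forall>x\<in>A. \<forall>y\<in>A. (x, y) \<in> r \<longleftrightarrow> (f x, f y) \<in> s)"

end

theory Submission
  imports Defs
begin

text \<open>Write \<open>\<beta> i\<close> for the representative of \<open>\<alpha> i - k\<close>. The ideal attached to \<open>(\<alpha>, k)\<close> is a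
  staircase: it contains the rows \<open>i \<le> k\<close> entirely, nothing in the rows \<open>i > k + p\<close>, and row
  \<open>k + m\<close> up to column \<open>k + max {\<beta> l | m \<le> l \<le> p}\<close>. Containment of staircases is
  the relation \<open>pbw_le\<close>. A PBW tuple is recovered from its suffix maxima: \<open>\<beta> m > p\<close> holds exactly where the
  suffix maximum strictly drops after position \<open>m\<close>, and \<open>\<beta> m\<close> is then that maximum. Conversely,
  a finite ideal with last nonempty row \<open>R\<close> is the staircase with \<open>k = max 0 (R - p)\<close>.\<close>

section \<open>Shifted tuples and their staircases\<close>

definition shift_tuple :: "int \<Rightarrow> int \<Rightarrow> (int \<Rightarrow> int) \<Rightarrow> nat \<Rightarrow> int \<Rightarrow> int" where
  "shift_tuple p n \<alpha> k = (\<lambda>j\<in>{1..p}. (\<alpha> j - int k) rmod n)"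

text \<open>The existential over \<open>l\<close> bounds \<open>j\<close> by a suffix maximum
  without a \<open>Max\<close>; taking \<open>k\<close> as an integer keeps row arithmetic free of
  coercions.\<close>

definition staircase :: "int \<Rightarrow> int \<Rightarrow> (int \<Rightarrow> int) \<Rightarrow> int \<Rightarrow> (int \<times> int) set" where
  "staircase p n \<beta> k =
     {(i, j) \<in> Q_elems p n. i \<le> k \<or> (\<exists>l\<in>{1..p}. i \<le> k + l \<and> j \<le> k + \<beta> l)}"

lemma rmod_add_diff:
  assumes "x \<in> {1..n}"
  shows "((x + k) rmod n - k) rmod n = x"
proof -
  have "((x + k) rmod n - k) rmod n = ((x + k - 1) mod n + (- k)) mod n + 1"
    by (simp add: rmod_def)
  also have "\<dots> = (x - 1) mod n + 1"
    by (simp add: mod_simps)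
  finally show ?thesis
    using assms by simp
qed

lemma rmod_diff_add:
  assumes "x \<in> {1..n}"
  shows "((x - k) rmod n + k) rmod n = x"
  using rmod_add_diff[OF assms, of "- k"] by simp

lemma pbw_tupleD:
  assumes "pbw_tuple p n \<beta>"
  shows "\<beta> \<in> tuples p n" "inj_on \<beta> {1..p}"
    "\<And>j. j \<in> {1..p} \<Longrightarrow> \<beta> j \<le> p \<Longrightarrow> \<beta> j = j"
    "\<And>j k. j \<in> {1..p} \<Longrightarrow> k \<in> {1..p} \<Longrightarrow> \<beta> k < \<beta> j \<Longrightarrow> p < \<beta> k \<Longrightarrow> j < k"
  using assms unfolding pbw_tuple_def by blast+

text \<open>An entry at most \<open>p\<close> is its own index, and any other exceeds every index.
  For \<open>1 \<le> p\<close> this gives \<open>p \<le> \<beta> p\<close>, so index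
  \<open>p\<close> often serves as default witness.\<close>

lemma pbw_tuple_ge:
  assumes "pbw_tuple p n \<beta>" "i \<in> {1..p}"
  shows "i \<le> \<beta> i"
  using pbw_tupleD(3)[OF assms] assms(2) by fastforce

lemma pbw_tuple_le:
  assumes "pbw_tuple p n \<beta>" "i \<in> {1..p}"
  shows "\<beta> i \<le> n"
  using pbw_tupleD(1)[OF assms(1)] assms(2) by (auto simp: tuples_def PiE_iff)

text \<open>The entries above \<open>p\<close> decrease along the tuple, and injectivity excludes
  ties.\<close>

lemma pbw_tuple_index_le:
  assumes "pbw_tuple p n \<beta>" "i \<in> {1..p}" "l \<in> {1..p}" "p < \<beta> i" "\<beta> i \<le> \<beta> l"
  shows "l \<le> i"
proof (cases "\<beta> i = \<beta> l")
  case True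
  then show ?thesis
    using inj_onD[OF pbw_tupleD(2)[OF assms(1)] True] assms(2,3) by simp
next
  case False
  then show ?thesis
    using pbw_tupleD(4)[OF assms(1,3,2)] assms(4,5) by simp
qed

lemma I_pbw_iff:
  "(\<alpha>, k) \<in> I_pbw p n \<longleftrightarrow> \<alpha> \<in> tuples p n \<and> pbw_tuple p n (shift_tuple p n \<alpha> k)"
  by (simp add: I_pbw_def shift_tuple_def)

lemma shift_tuple_inject:
  assumes "\<alpha> \<in> tuples p n" "\<alpha>' \<in> tuples p n" "shift_tuple p n \<alpha> k = shift_tuple p n \<alpha>' k"
  shows "\<alpha> = \<alpha>'"
proof (rule extensionalityI[where A = "{1..p}"])
  show "\<alpha> \<in> extensional {1..p}" "\<alpha>' \<in> extensional {1..p}"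
    using assms by (auto simp: tuples_def PiE_iff)
  fix j assume j: "j \<in> {1..p}"
  have "(\<alpha> j - int k) rmod n = (\<alpha>' j - int k) rmod n"
    using fun_cong[OF assms(3), of j] j by (simp add: shift_tuple_def)
  moreover have "\<alpha> j \<in> {1..n}" "\<alpha>' j \<in> {1..n}"
    using assms j by (auto simp: tuples_def PiE_iff)
  ultimately show "\<alpha> j = \<alpha>' j"
    using rmod_diff_add by metis
qed

lemma shift_tuple_surj:
  assumes "0 < n" "\<beta> \<in> tuples p n"
  obtains \<alpha> where "\<alpha> \<in> tuples p n" "shift_tuple p n \<alpha> k = \<beta>"
proof
  let ?\<alpha> = "\<lambda>j\<in>{1..p}. (\<beta> j + int k) rmod n"
  show "?\<alpha> \<in> tuples p n"
    unfolding tuples_def by (intro restrict_PiE_iff[THEN iffD2] ballI rmod_range assms)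
  show "shift_tuple p n ?\<alpha> k = \<beta>"
  proof (rule extensionalityI[where A = "{1..p}"])
    fix j assume "j \<in> {1..p}"
    then show "shift_tuple p n ?\<alpha> k j = \<beta> j"
      using assms rmod_add_diff[of "\<beta> j" n "int k"]
      by (auto simp: shift_tuple_def tuples_def PiE_iff)
  qed (use assms in \<open>auto simp: shift_tuple_def tuples_def PiE_iff\<close>)
qed

lemma pbw_le_iff:
  assumes "(\<alpha>, k) \<in> I_pbw p n" "(\<alpha>', k') \<in> I_pbw p n"
  shows "((\<alpha>, k), (\<alpha>', k')) \<in> pbw_le p n \<longleftrightarrow> k \<le> k' \<and>
     (\<forall>i\<in>{int k' - int k + 1..p}. \<exists>i'\<in>{i - (int k' - int k)..p}.
        int k + shift_tuple p n \<alpha> k i \<le> int k' + shift_tuple p n \<alpha>' k' i')"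
proof (cases "k \<le> k'")
  case True
  \<comment> \<open>\<open>k \<le> k'\<close> puts both indices into \<open>{1..p}\<close>, where
    \<open>shift_tuple\<close> has its intended value.\<close>
  then have "int k + shift_tuple p n \<alpha> k i \<le> int k' + shift_tuple p n \<alpha>' k' i' \<longleftrightarrow>
      int k + (\<alpha> i - int k) rmod n \<le> int k' + (\<alpha>' i' - int k') rmod n"
    if "i \<in> {int k' - int k + 1..p}" "i' \<in> {i - (int k' - int k)..p}" for i i'
  proof -
    have "i \<in> {1..p}" "i' \<in> {1..p}"
      using that True by auto
    then show ?thesis
      by (simp add: shift_tuple_def)
  qed
  then show ?thesis
    using assms True by (simp add: pbw_le_def del: atLeastAtMost_iff cong: ball_cong bex_cong)
qed (simp add: pbw_le_def)

section \<open>Generated ideals are staircases\<close>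

text \<open>By minimality two facts suffice: the staircase is an order ideal containing the
  generators, and each of its elements lies below some generator.\<close>

lemma phi_pbw_eq_staircase:
  assumes "1 \<le> p" "p < n" "(\<alpha>, k) \<in> I_pbw p n"
  shows "phi_pbw p n (\<alpha>, k) = staircase p n (shift_tuple p n \<alpha> k) (int k)"
    (is "_ = staircase p n ?\<beta> _")
proof -
  have \<beta>: "pbw_tuple p n ?\<beta>"
    using assms(3) by (simp add: I_pbw_iff)
  have \<beta>p: "p \<le> ?\<beta> p"
    using pbw_tuple_ge[OF \<beta>, of p] assms by simp
  have \<beta>n: "?\<beta> l \<le> n" if "l \<in> {1..p}" for l
    using pbw_tuple_le[OF \<beta> that] .
  have gens: "phi_gens p n (\<alpha>, k) = {(int k + l, int k + ?\<beta> l) | l. l \<in> {1..p} \<and> int k + ?\<beta> l > p}"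
    by (auto simp: phi_gens_def shift_tuple_def)
  have sub: "phi_gens p n (\<alpha>, k) \<subseteq> Q_elems p n"
    using phi_gens_subset[OF assms] .
  note least = ideal_generated_least[OF sub, of "Q_le p n", folded phi_pbw_def]
  show ?thesis
  proof
    show "phi_pbw p n (\<alpha>, k) \<subseteq> staircase p n ?\<beta> (int k)"
    proof (rule least(3))
      show "phi_gens p n (\<alpha>, k) \<subseteq> staircase p n ?\<beta> (int k)"
        using sub by (auto simp: gens staircase_def)
      show "order_ideal (Q_elems p n) (Q_le p n) (staircase p n ?\<beta> (int k))"
        unfolding order_ideal_def
      proof (intro conjI ballI impI)
        show "staircase p n ?\<beta> (int k) \<subseteq> Q_elems p n"
          by (auto simp: staircase_def)
        fix y x
        assume y: "y \<in> staircase p n ?\<beta> (int k)" and x: "x \<in> Q_elems p n" "(x, y) \<in> Q_le p n"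
        obtain i j i' j' where xy: "x = (i, j)" "y = (i', j')"
          by force
        have Q: "i \<le> j" "0 \<le> j' - i'" "j' - i' \<le> n - 1"
          using x by (auto simp: xy Q_le_def Q_elems_def)
        consider "i \<le> i'" "j \<le> j'" | "i + p \<le> i'" | "j + n - p \<le> j'"
          using x by (auto simp: xy Q_le_def)
        then have "i \<le> int k \<or> (\<exists>l\<in>{1..p}. i \<le> int k + l \<and> j \<le> int k + ?\<beta> l)"
        proof cases
          case 1
          then show ?thesis
            using y by (fastforce simp: xy staircase_def)
        next
          case 2
          then have "i \<le> int k"
            using y assms by (auto simp: xy staircase_def)
          then show ?thesis ..
        next
          case 3
          \<comment> \<open>In a full row \<open>j' < i' + n\<close>, elsewhere
            \<open>\<beta> l \<le> n\<close>. Hence \<open>j \<le> k + p\<close>, and since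
            \<open>i \<le> j\<close> the index \<open>p\<close> is a witness.\<close>
          have "j' \<le> int k + n"
            using y Q \<beta>n by (fastforce simp: xy staircase_def)
          then have "j \<le> int k + p"
            using 3 by linarith
          then have "i \<le> int k + p \<and> j \<le> int k + ?\<beta> p"
            using Q \<beta>p by linarith
          then show ?thesis
            using assms by auto
        qed
        then show "x \<in> staircase p n ?\<beta> (int k)"
          using x by (auto simp: xy staircase_def)
      qed
    qed
    show "staircase p n ?\<beta> (int k) \<subseteq> phi_pbw p n (\<alpha>, k)"
    proof
      fix x assume x: "x \<in> staircase p n ?\<beta> (int k)"
      obtain i j where xeq: "x = (i, j)" by force
      have Q: "(i, j) \<in> Q_elems p n"
        using x by (simp add: xeq staircase_def)
      then have ij: "1 \<le> i" "p + 1 \<le> j"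
        by (auto simp: Q_elems_def)
      have "\<exists>g\<in>phi_gens p n (\<alpha>, k). (x, g) \<in> Q_le p n"
      proof (cases "i \<le> int k")
        case True
        \<comment> \<open>\<open>1 \<le> i \<le> k\<close> forces \<open>k > 0\<close>, so the
          generator of index \<open>p\<close> has a column above \<open>p\<close>; it dominates row
          \<open>i\<close> through \<open>i + p \<le> k + p\<close>.\<close>
        then have "(int k + p, int k + ?\<beta> p) \<in> phi_gens p n (\<alpha>, k)"
          using \<beta>p ij assms by (auto simp: gens)
        moreover from this have "(x, (int k + p, int k + ?\<beta> p)) \<in> Q_le p n"
          using sub Q True by (auto simp: xeq Q_le_def)
        ultimately show ?thesis by blast
      next
        case False
        then obtain l where l: "l \<in> {1..p}" "i \<le> int k + l" "j \<le> int k + ?\<beta> l"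
          using x by (auto simp: xeq staircase_def)
        then have "(int k + l, int k + ?\<beta> l) \<in> phi_gens p n (\<alpha>, k)"
          using ij by (auto simp: gens)
        moreover from this have "(x, (int k + l, int k + ?\<beta> l)) \<in> Q_le p n"
          using sub Q l by (auto simp: xeq Q_le_def)
        ultimately show ?thesis by blast
      qed
      then show "x \<in> phi_pbw p n (\<alpha>, k)"
        using least(1,2) Q unfolding order_ideal_def xeq by blast
    qed
  qed
qed

lemma finite_staircase: "finite (staircase p n \<beta> k)"
proof (rule finite_subset)
  \<comment> \<open>Rows bound columns through \<open>j - i < n\<close>; the absolute value lets the
    box also cover negative \<open>p\<close>.\<close>
  show "staircase p n \<beta> k \<subseteq> {1..k + \<bar>p\<bar>} \<times> {1 + p..k + \<bar>p\<bar> + n}"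
    by (force simp: staircase_def Q_elems_def)
qed simp

lemma phi_pbw_in_finite_ideals:
  assumes "1 \<le> p" "p < n" "x \<in> I_pbw p n"
  shows "phi_pbw p n x \<in> finite_ideals (Q_elems p n) (Q_le p n)"
proof -
  have "finite (phi_pbw p n x)"
    using phi_pbw_eq_staircase assms finite_staircase by (metis prod.collapse)
  then show ?thesis
    using ideal_generated_least(1)[OF phi_gens_subset[OF assms]]
    by (simp add: finite_ideals_def phi_pbw_def)
qed

section \<open>Containment of staircases\<close>

text \<open>Forwards, the inclusion is tested at the corners \<open>(k + i, k + \<beta> i)\<close>.
  Backwards, a cell past row \<open>k'\<close> has row and column at most those of such a corner,
  whose bound transfers.\<close>

lemma staircase_subset_iff:
  assumes "1 \<le> p" "p < n" "pbw_tuple p n \<beta>" "pbw_tuple p n \<beta>'" "0 \<le> k" "0 \<le> k'"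
  shows "staircase p n \<beta> k \<subseteq> staircase p n \<beta>' k' \<longleftrightarrow> k \<le> k' \<and>
     (\<forall>i\<in>{k' - k + 1..p}. \<exists>i'\<in>{i - (k' - k)..p}. k + \<beta> i \<le> k' + \<beta>' i')"
    (is "?L \<longleftrightarrow> _ \<and> ?R")
proof (intro iffI conjI)
  have \<beta>p: "p \<le> \<beta> p" "p \<le> \<beta>' p"
    using assms pbw_tuple_ge[of p n _ p] by auto
  assume L: ?L
  show le: "k \<le> k'"
  proof (rule ccontr)
    assume "\<not> k \<le> k'"
    \<comment> \<open>This diagonal cell lies in \<open>Q_elems\<close> since \<open>k > 0\<close>,
      but beyond the last row \<open>k' + p\<close> of the other staircase.\<close>
    then have "(k + p, k + p) \<in> staircase p n \<beta> k"
      using assms \<beta>p by (auto simp: staircase_def Q_elems_def)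
    then have "(k + p, k + p) \<in> staircase p n \<beta>' k'"
      using L by blast
    then show False
      using \<open>\<not> k \<le> k'\<close> assms by (auto simp: staircase_def)
  qed
  show ?R
  proof
    fix i assume i: "i \<in> {k' - k + 1..p}"
    then have i1: "i \<in> {1..p}"
      using le by auto
    show "\<exists>i'\<in>{i - (k' - k)..p}. k + \<beta> i \<le> k' + \<beta>' i'"
    \<comment> \<open>A corner belongs to \<open>Q_elems\<close> only if its column exceeds
      \<open>p\<close>; otherwise index \<open>p\<close> serves, since
      \<open>k' + \<beta>' p \<ge> p\<close>.\<close>
    proof (cases "k + \<beta> i > p")
      case True
      then have "(k + i, k + \<beta> i) \<in> staircase p n \<beta> k"
        using i1 pbw_tuple_ge[OF assms(3) i1] pbw_tuple_le[OF assms(3) i1] assms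
        by (auto simp: staircase_def Q_elems_def)
      then have "(k + i, k + \<beta> i) \<in> staircase p n \<beta>' k'"
        using L by blast
      \<comment> \<open>\<open>i > k' - k\<close> places row \<open>k + i\<close> past the full
        rows, so membership must come from some \<open>l\<close>.\<close>
      then obtain l where "l \<in> {1..p}" "k + i \<le> k' + l" "k + \<beta> i \<le> k' + \<beta>' l"
        using i by (auto simp: staircase_def)
      then show ?thesis
        by (intro bexI[of _ l]) auto
    next
      case False
      then show ?thesis
        using i \<beta>p assms le by (intro bexI[of _ p]) auto
    qed
  qed
next
  assume R: "k \<le> k' \<and> ?R"
  show ?L
  proof
    fix x assume x: "x \<in> staircase p n \<beta> k"
    obtain i j where xeq: "x = (i, j)" by force
    have "i \<le> k' \<or> (\<exists>l\<in>{1..p}. i \<le> k' + l \<and> j \<le> k' + \<beta>' l)"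
    proof (cases "i \<le> k'")
      case False
      then obtain l where l: "l \<in> {1..p}" "i \<le> k + l" "j \<le> k + \<beta> l"
        using x R by (auto simp: xeq staircase_def)
      then have "l \<in> {k' - k + 1..p}"
        using False by auto
      then obtain l' where "l' \<in> {l - (k' - k)..p}" "k + \<beta> l \<le> k' + \<beta>' l'"
        using R by blast
      then show ?thesis
        using l False by (intro disjI2 bexI[of _ l']) auto
    qed simp
    then show "x \<in> staircase p n \<beta>' k'"
      using x by (auto simp: xeq staircase_def)
  qed
qed

section \<open>Recovering the tuple from its staircase\<close>

text \<open>Chasing both dominations gives \<open>m \<le> l \<le> l'\<close> with
  \<open>\<beta> m \<le> \<beta>' l \<le> \<beta> l'\<close>. No later entry reaches an entry above
  \<open>p\<close>, so both indices collapse to \<open>m\<close>.\<close>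

lemma pbw_tuple_eq_if_dominated:
  assumes "pbw_tuple p n \<beta>" "pbw_tuple p n \<beta>'" "m \<in> {1..p}" "p < \<beta> m"
    and "\<forall>i\<in>{1..p}. \<exists>l\<in>{i..p}. \<beta> i \<le> \<beta>' l" "\<forall>i\<in>{1..p}. \<exists>l\<in>{i..p}. \<beta>' i \<le> \<beta> l"
  shows "\<beta> m = \<beta>' m"
proof -
  obtain l where l: "l \<in> {m..p}" "\<beta> m \<le> \<beta>' l"
    using assms by blast
  then have "l \<in> {1..p}"
    using assms(3) by auto
  then obtain l' where l': "l' \<in> {l..p}" "\<beta>' l \<le> \<beta> l'"
    using assms by blast
  then have "l' \<le> m"
    using pbw_tuple_index_le[OF assms(1,3), of l'] assms(3,4) l by auto
  then have "l = m" "l' = m"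
    using l l' by auto
  then show ?thesis
    using l l' by auto
qed

text \<open>The two inclusions force \<open>k = k'\<close> and mutual domination, which settles
  positions where either entry exceeds \<open>p\<close>; where neither does, both equal the
  index.\<close>

lemma staircase_inject:
  assumes "1 \<le> p" "p < n" "pbw_tuple p n \<beta>" "pbw_tuple p n \<beta>'" "0 \<le> k" "0 \<le> k'"
    and eq: "staircase p n \<beta> k = staircase p n \<beta>' k'"
  shows "k = k'" "\<beta> = \<beta>'"
proof -
  have sub: "staircase p n \<beta> k \<subseteq> staircase p n \<beta>' k'" "staircase p n \<beta>' k' \<subseteq> staircase p n \<beta> k"
    using eq by auto
  note iffs = sub(1)[unfolded staircase_subset_iff[OF assms(1-6)]]
    sub(2)[unfolded staircase_subset_iff[OF assms(1,2,4,3,6,5)]]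
  show k: "k = k'"
    using iffs by simp
  have dom: "\<forall>i\<in>{1..p}. \<exists>l\<in>{i..p}. \<beta> i \<le> \<beta>' l" "\<forall>i\<in>{1..p}. \<exists>l\<in>{i..p}. \<beta>' i \<le> \<beta> l"
    using iffs by (simp_all add: k)
  show "\<beta> = \<beta>'"
  proof (rule extensionalityI[where A = "{1..p}"])
    show "\<beta> \<in> extensional {1..p}" "\<beta>' \<in> extensional {1..p}"
      using assms(3,4)[THEN pbw_tupleD(1)] by (auto simp: tuples_def PiE_iff)
    fix m assume m: "m \<in> {1..p}"
    consider "p < \<beta> m" | "p < \<beta>' m" | "\<beta> m \<le> p" "\<beta>' m \<le> p"
      by linarith
    then show "\<beta> m = \<beta>' m"
    proof cases
      case 1
      then show ?thesis
        using pbw_tuple_eq_if_dominated[OF assms(3,4) m _ dom] by simp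
    next
      case 2
      then show ?thesis
        using pbw_tuple_eq_if_dominated[OF assms(4,3) m _ dom(2,1)] by simp
    next
      case 3
      then show ?thesis
        using assms(3,4)[THEN pbw_tupleD(3)[OF _ m]] by simp
    qed
  qed
qed

section \<open>Tuples with prescribed suffix maxima\<close>

text \<open>\<open>H (p + 1) = p\<close> is a sentinel: position \<open>p\<close> is a drop exactly
  when \<open>H p > p\<close>, and otherwise the entry \<open>p\<close> itself attains the
  maximum.\<close>

lemma pbw_tuple_with_suffix_maxima:
  fixes H :: "int \<Rightarrow> int"
  assumes "1 \<le> p" and Hp: "H (p + 1) = p"
    and range: "\<And>m. m \<in> {1..p} \<Longrightarrow> H m \<in> {p..n}"
    and anti: "\<And>l m. 1 \<le> l \<Longrightarrow> l \<le> m \<Longrightarrow> m \<le> p + 1 \<Longrightarrow> H m \<le> H l"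
  obtains \<beta> where "pbw_tuple p n \<beta>"
    "\<And>m c. m \<in> {1..p} \<Longrightarrow> (\<exists>l\<in>{m..p}. c \<le> \<beta> l) \<longleftrightarrow> c \<le> H m"
proof
  \<comment> \<open>Positions without a drop receive \<open>m\<close>, the only admissible value up
    to \<open>p\<close>; it never exceeds \<open>H m\<close> because
    \<open>p \<le> H m\<close>.\<close>
  define \<beta> where "\<beta> = (\<lambda>m\<in>{1..p}. if H (m + 1) < H m then H m else m)"
  have eq: "\<beta> m = (if H (m + 1) < H m then H m else m)" if "m \<in> {1..p}" for m
    using that by (simp add: \<beta>_def)
  have big: "p \<le> H (m + 1)" if "m \<in> {1..p}" for m
    using anti[of "m + 1" "p + 1"] that Hp by auto
  \<comment> \<open>\<open>\<beta> l > p\<close> means that \<open>H\<close> drops after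
    \<open>l\<close>, so all later entries are at most \<open>H (l + 1)\<close>.\<close>
  have less: "\<beta> m < \<beta> l" if "l \<in> {1..p}" "m \<in> {1..p}" "l < m" "p < \<beta> l" for l m
  proof -
    have l: "H (l + 1) < H l" "\<beta> l = H l"
      using that by (auto simp: eq split: if_splits)
    have "H m \<le> H (l + 1)"
      using anti[of "l + 1" m] that by auto
    moreover have "\<beta> m \<le> H m"
      using range[OF that(2)] that(2) by (auto simp: eq)
    ultimately show ?thesis
      using l by linarith
  qed
  show "pbw_tuple p n \<beta>"
    unfolding pbw_tuple_def
  proof (intro conjI ballI impI)
    have "\<beta> m \<in> {1..n}" if "m \<in> {1..p}" for m
      using range[OF that] that by (auto simp: eq)
    then show "\<beta> \<in> tuples p n"
      by (auto simp: tuples_def PiE_iff \<beta>_def)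
    show small: "\<beta> m = m" if "m \<in> {1..p}" "\<beta> m \<le> p" for m
      using that big[OF that(1)] by (auto simp: eq split: if_splits)
    show "inj_on \<beta> {1..p}"
    proof (rule linorder_inj_onI)
      fix l m assume lm: "l < m" "l \<in> {1..p}" "m \<in> {1..p}"
      show "\<beta> l \<noteq> \<beta> m"
        using less[of l m] small[of l] small[of m] lm by force
    qed auto
    show "j < k" if "j \<in> {1..p}" "k \<in> {1..p}" "\<beta> k < \<beta> j \<and> p < \<beta> k" for j k
      using less[of k j] that by (cases j k rule: linorder_cases) auto
  qed
  fix m c :: int assume m: "m \<in> {1..p}"
  show "(\<exists>l\<in>{m..p}. c \<le> \<beta> l) \<longleftrightarrow> c \<le> H m"
  proof
    assume "\<exists>l\<in>{m..p}. c \<le> \<beta> l"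
    then obtain l where l: "l \<in> {m..p}" "c \<le> \<beta> l" by blast
    then have "l \<in> {1..p}"
      using m by auto
    then have "\<beta> l \<le> H l"
      using range[of l] by (auto simp: eq)
    also have "H l \<le> H m"
      using anti[of m l] l m by auto
    finally show "c \<le> H m"
      using l by linarith
  next
    assume c: "c \<le> H m"
    \<comment> \<open>At the last position with value \<open>H m\<close>, either \<open>H\<close>
      drops right after it, or it is \<open>p\<close> and \<open>H m = p\<close>; both times
      \<open>\<beta> l = H m\<close>.\<close>
    define l where "l = Max {l \<in> {m..p}. H l = H m}"
    have fin: "finite {l \<in> {m..p}. H l = H m}"
      by (rule finite_subset[of _ "{m..p}"]) auto
    have "l \<in> {l \<in> {m..p}. H l = H m}"
      unfolding l_def using m by (intro Max_in fin) auto
    then have l: "l \<in> {m..p}" "H l = H m"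
      by auto
    have "H m \<le> \<beta> l"
    proof (cases "l = p")
      case True
      then show ?thesis
        using l assms m Hp anti[of l "l + 1"] by (auto simp: eq)
    next
      case False
      have "H (l + 1) \<noteq> H m"
      proof
        assume "H (l + 1) = H m"
        then have "l + 1 \<in> {l \<in> {m..p}. H l = H m}"
          using l False by auto
        from Max_ge[OF fin this, folded l_def] have "l + 1 \<le> l" .
        then show False by simp
      qed
      then show ?thesis
        using l m anti[of l "l + 1"] by (auto simp: eq)
    qed
    then show "\<exists>l\<in>{m..p}. c \<le> \<beta> l"
      using l(1) c by force
  qed
qed

section \<open>Every finite ideal is a staircase\<close>

text \<open>\<open>k\<close> is the excess over \<open>p\<close> of the last nonempty row, or 0 if
  no row beyond \<open>p\<close> is occupied. The third property later fills all rows up to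
  \<open>k\<close>.\<close>

lemma finite_ideal_last_row:
  assumes "1 \<le> p" "J \<in> finite_ideals (Q_elems p n) (Q_le p n)"
  obtains k where "0 \<le> k" "\<And>i j. (i, j) \<in> J \<Longrightarrow> i \<le> k + p"
    "0 < k \<Longrightarrow> \<exists>j. (k + p, j) \<in> J"
proof (cases "\<exists>i j. (i, j) \<in> J \<and> p < i")
  case True
  have fin: "finite (fst ` J)"
    using assms by (auto simp: finite_ideals_def)
  define R where "R = Max (fst ` J)"
  have "R \<in> fst ` J"
    unfolding R_def using True fin by (intro Max_in) auto
  moreover have "i \<le> R" if "(i, j) \<in> J" for i j
    unfolding R_def using fin that by (force intro: Max_ge)
  ultimately show ?thesis
    using True by (intro that[of "R - p"]) force+
next
  case False
  then show ?thesis
    by (intro that[of 0]) force+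
qed

text \<open>The row ends of \<open>J\<close>, shifted by \<open>k\<close> and raised to at least
  \<open>p\<close>, form a weakly decreasing function with values in \<open>{p..n}\<close>, hence
  are the suffix maxima of a PBW tuple.\<close>

lemma staircase_surj:
  assumes p: "1 \<le> p" and n: "p < n" and J: "J \<in> finite_ideals (Q_elems p n) (Q_le p n)"
  obtains \<beta> and k :: nat where "pbw_tuple p n \<beta>" "J = staircase p n \<beta> (int k)"
proof -
  obtain k where k: "0 \<le> k" "\<And>i j. (i, j) \<in> J \<Longrightarrow> i \<le> k + p"
    "0 < k \<Longrightarrow> \<exists>j. (k + p, j) \<in> J"
    using finite_ideal_last_row[OF p J] by metis
  have JQ: "J \<subseteq> Q_elems p n" and fin: "finite J"
    using J by (auto simp: finite_ideals_def order_ideal_def)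
  have down: "(i, j) \<in> J" if "(i', j') \<in> J" "(i, j) \<in> Q_elems p n"
      "i \<le> i' \<and> j \<le> j' \<or> i + p \<le> i' \<or> j + n - p \<le> j'" for i j i' j'
  proof -
    have "((i, j), (i', j')) \<in> Q_le p n"
      using that JQ by (auto simp: Q_le_def)
    then show ?thesis
      using J that(1,2) unfolding finite_ideals_def order_ideal_def by blast
  qed
  \<comment> \<open>Through \<open>j1 + n - p \<le> j2\<close>, a cell beyond column
    \<open>k + n\<close> would lie above a cell of row \<open>k + p + 1\<close>, which is
    empty.\<close>
  have bound: "j \<le> k + n" if "(i, j) \<in> J" for i j
  proof (rule ccontr)
    assume "\<not> j \<le> k + n"
    then have "(k + p + 1, k + p + 1) \<in> J"
      using that k(1) p n by (intro down[OF that]) (auto simp: Q_elems_def)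
    then show False
      using k(2) by fastforce
  qed
  \<comment> \<open>The default \<open>p\<close> covers empty rows and matches
    \<open>p \<le> \<beta> p\<close>: no suffix maximum of a PBW tuple is smaller.\<close>
  define C where "C m = insert p {j - k | j. (k + m, j) \<in> J}" for m
  define H where "H m = Max (C m)" for m
  have finC: "finite (C m)" for m
  proof -
    have "{j - k | j. (k + m, j) \<in> J} \<subseteq> (\<lambda>x. snd x - k) ` J"
      by force
    then show ?thesis
      using fin by (auto simp: C_def intro: finite_subset)
  qed
  have H_in: "H m \<in> C m" for m
    unfolding H_def using finC by (intro Max_in) (auto simp: C_def)
  have H_ge: "c \<le> H m" if "c \<in> C m" for c m
    unfolding H_def using finC that by (rule Max_ge)
  have H_p: "p \<le> H m" for m
    by (rule H_ge) (simp add: C_def)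
  have "C (p + 1) = {p}"
    using k(2) by (fastforce simp: C_def)
  then have Hp1: "H (p + 1) = p"
    by (simp add: H_def)
  have H_n: "H m \<le> n" for m
    using H_in[of m] bound n by (fastforce simp: C_def)
  have anti: "H m \<le> H l" if "1 \<le> l" "l \<le> m" for l m
  proof -
    consider "H m = p" | j where "H m = j - k" "(k + m, j) \<in> J"
      using H_in[of m] by (auto simp: C_def)
    then show ?thesis
    proof cases
      case 1
      then show ?thesis using H_p by simp
    next
      case 2
      have "(k + m, j) \<in> Q_elems p n"
        using 2 JQ by blast
      \<comment> \<open>In the earlier row the difference stays below \<open>n\<close> because
        \<open>j \<le> k + n\<close> and \<open>1 \<le> l\<close>.\<close>
      then have "(k + l, j) \<in> Q_elems p n"
        using that bound[OF 2(2)] k(1) by (auto simp: Q_elems_def)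
      then have "(k + l, j) \<in> J"
        using that by (intro down[OF 2(2)]) auto
      then show ?thesis
        using 2 by (intro H_ge) (auto simp: C_def)
    qed
  qed
  obtain \<beta> where \<beta>: "pbw_tuple p n \<beta>"
    "\<And>m c. m \<in> {1..p} \<Longrightarrow> (\<exists>l\<in>{m..p}. c \<le> \<beta> l) \<longleftrightarrow> c \<le> H m"
  proof (rule pbw_tuple_with_suffix_maxima[of p H n])
    show "H m \<in> {p..n}" for m
      using H_p H_n by simp
  qed (use p Hp1 anti in auto)
  have row: "(k + m, j) \<in> J \<longleftrightarrow> j - k \<le> H m" if Q: "(k + m, j) \<in> Q_elems p n" "m \<in> {1..p}" for m j
  proof
    assume "(k + m, j) \<in> J"
    then show "j - k \<le> H m"
      by (intro H_ge) (auto simp: C_def)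
  next
    assume le: "j - k \<le> H m"
    consider "H m = p" | j' where "H m = j' - k" "(k + m, j') \<in> J"
      using H_in[of m] by (auto simp: C_def)
    then show "(k + m, j) \<in> J"
    proof cases
      case 1
      \<comment> \<open>The default adds no cells: \<open>p < j \<le> k + p\<close> forces
        \<open>k > 0\<close>, so row \<open>k + p\<close> has a cell, whose column is at least
        \<open>k + p\<close>.\<close>
      then have "0 < k"
        using le Q by (auto simp: Q_elems_def)
      then obtain j' where j': "(k + p, j') \<in> J"
        using k(3) by blast
      then have "k + p \<le> j'"
        using JQ by (auto simp: Q_elems_def)
      then show ?thesis
        using Q 1 le by (intro down[OF j']) auto
    next
      case 2
      then show ?thesis
        using Q le by (intro down[OF 2(2)]) auto
    qed
  qed
  have "(i, j) \<in> J \<longleftrightarrow> (i, j) \<in> staircase p n \<beta> k" if Q: "(i, j) \<in> Q_elems p n" for i j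
  proof -
    consider "i \<le> k" | "i > k + p" | m where "i = k + m" "m \<in> {1..p}"
      using that(1,2) that(3)[of "i - k"] by fastforce
    then show ?thesis
    proof cases
      case 1
      \<comment> \<open>\<open>1 \<le> i \<le> k\<close> makes row \<open>k + p\<close> nonempty,
        and any cell there lies above all of row \<open>i\<close> by
        \<open>i + p \<le> k + p\<close>.\<close>
      then obtain j' where j': "(k + p, j') \<in> J"
        using k(3) Q by (auto simp: Q_elems_def)
      then have "(i, j) \<in> J"
        using Q 1 by (intro down[OF j']) auto
      then show ?thesis
        using 1 Q by (simp add: staircase_def)
    next
      case 2
      then show ?thesis
        using k(2) p by (fastforce simp: staircase_def)
    next
      case 3
      have "(i, j) \<in> staircase p n \<beta> k \<longleftrightarrow> (\<exists>l\<in>{m..p}. j - k \<le> \<beta> l)"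
        using 3 Q by (force simp: staircase_def algebra_simps)
      then show ?thesis
        using row[of m j] \<beta>(2)[of m "j - k"] 3 Q by simp
    qed
  qed
  then have "J = staircase p n \<beta> (int (nat k))"
    using JQ k(1) by (auto simp: staircase_def)
  then show thesis
    using that \<beta>(1) by blast
qed

section \<open>Transfer from staircases to the isomorphism\<close>

theorem proposition5p15:
  fixes p n :: int
  assumes "1 \<le> p" and "p < n"
  shows "poset_iso (I_pbw p n) (pbw_le p n)
           (finite_ideals (Q_elems p n) (Q_le p n))
           (inclusion_on (finite_ideals (Q_elems p n) (Q_le p n)))
           (phi_pbw p n)"
proof -
  let ?I = "I_pbw p n" and ?F = "finite_ideals (Q_elems p n) (Q_le p n)" and ?\<phi> = "phi_pbw p n"
  note eq = phi_pbw_eq_staircase[OF assms]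
  have inj: "inj_on ?\<phi> ?I"
  proof (rule inj_onI, clarify)
    fix \<alpha> k \<alpha>' k'
    assume x: "(\<alpha>, k) \<in> ?I" "(\<alpha>', k') \<in> ?I" "?\<phi> (\<alpha>, k) = ?\<phi> (\<alpha>', k')"
    then have *: "pbw_tuple p n (shift_tuple p n \<alpha> k)" "pbw_tuple p n (shift_tuple p n \<alpha>' k')"
      and tup: "\<alpha> \<in> tuples p n" "\<alpha>' \<in> tuples p n"
      by (simp_all add: I_pbw_iff)
    have "int k = int k'" "shift_tuple p n \<alpha> k = shift_tuple p n \<alpha>' k'"
      using staircase_inject[OF assms *, of "int k" "int k'"] x by (simp_all add: eq)
    then show "\<alpha> = \<alpha>' \<and> k = k'"
      using shift_tuple_inject[OF tup] by simp
  qed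
  have surj: "?\<phi> ` ?I = ?F"
  proof
    show "?\<phi> ` ?I \<subseteq> ?F"
      using phi_pbw_in_finite_ideals[OF assms] by blast
    show "?F \<subseteq> ?\<phi> ` ?I"
    proof
      fix J assume "J \<in> ?F"
      then obtain \<beta> and k :: nat where \<beta>: "pbw_tuple p n \<beta>" "J = staircase p n \<beta> (int k)"
        using staircase_surj[OF assms] by blast
      obtain \<alpha> where "\<alpha> \<in> tuples p n" "shift_tuple p n \<alpha> k = \<beta>"
        using shift_tuple_surj[of n \<beta> p k] pbw_tupleD(1)[OF \<beta>(1)] assms by auto
      then have "(\<alpha>, k) \<in> ?I" "?\<phi> (\<alpha>, k) = J"
        using \<beta> by (simp_all add: I_pbw_iff eq)
      then show "J \<in> ?\<phi> ` ?I"
        by blast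
    qed
  qed
  have ord: "(x, y) \<in> pbw_le p n \<longleftrightarrow> ?\<phi> x \<subseteq> ?\<phi> y" if "x \<in> ?I" "y \<in> ?I" for x y
  proof -
    obtain \<alpha> k \<alpha>' k' where xy: "x = (\<alpha>, k)" "y = (\<alpha>', k')"
      by force
    have "pbw_tuple p n (shift_tuple p n \<alpha> k)" "pbw_tuple p n (shift_tuple p n \<alpha>' k')"
      using that by (simp_all add: xy I_pbw_iff)
    from staircase_subset_iff[OF assms this, of "int k" "int k'"] show ?thesis
      using that by (simp add: xy eq pbw_le_iff)
  qed
  have sub: "pbw_le p n \<subseteq> ?I \<times> ?I"
    by (auto simp: pbw_le_def)
  \<comment> \<open>The order axioms are pulled back from inclusion along \<open>?\<phi>\<close>;
    antisymmetry is where injectivity enters.\<close>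
  have "partial_order_on ?I (pbw_le p n)"
    unfolding partial_order_on_def preorder_on_def
  proof (intro conjI sub)
    show "refl_on ?I (pbw_le p n)"
      by (simp add: refl_on_def ord)
    show "trans (pbw_le p n)"
    proof (rule transI)
      fix x y z
      assume xyz: "(x, y) \<in> pbw_le p n" "(y, z) \<in> pbw_le p n"
      then have "x \<in> ?I" "y \<in> ?I" "z \<in> ?I"
        using sub by blast+
      then show "(x, z) \<in> pbw_le p n"
        using xyz by (auto simp only: ord)
    qed
    show "antisym (pbw_le p n)"
    proof (rule antisymI)
      fix x y
      assume xy: "(x, y) \<in> pbw_le p n" "(y, x) \<in> pbw_le p n"
      then have "x \<in> ?I" "y \<in> ?I"
        using sub by blast+
      then show "x = y"
        using xy inj by (auto simp only: ord inj_on_def)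
    qed
  qed
  moreover have "partial_order_on ?F (inclusion_on ?F)"
    by (auto simp: partial_order_on_def preorder_on_def refl_on_def inclusion_on_def
        intro!: transI antisymI)
  moreover have "bij_betw ?\<phi> ?I ?F"
    using inj surj by (simp add: bij_betw_def)
  moreover have "(x, y) \<in> pbw_le p n \<longleftrightarrow> (?\<phi> x, ?\<phi> y) \<in> inclusion_on ?F"
    if "x \<in> ?I" "y \<in> ?I" for x y
    using that surj by (auto simp: inclusion_on_def ord)
  ultimately show ?thesis
    by (simp add: poset_iso_def)
qed

end
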